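(* Let $\epsilon\in(0,1)$, let $\|\cdot\|$ be a norm on $\mathbb{R}^d$, and let $D_{\mathrm{cal},1}=\{\tilde{\mathbf Y}^{(i)}_{0:T-1}\}_{i=1}^{n_1}$ be residual sequences in $\mathbb{R}^{d\times T}$ with $\epsilon\ge 1/(n_1+1)$. Put $p_1=\lceil(1-\epsilon)(n_1+1)\rceil$ and $\tilde e_t^{(i)}=\|\tilde Y_t^{(i)}\|$. Let $r_0^*,\dots,r_{T-1}^*$ be optimal radii of the mixed-integer linear program $$\min_{r\in\mathbb{R}^T,\ b\in\{0,1\}^{n_1}}\ \sum_{t=0}^{T-1}r_t\quad\text{s.t.}\quad r_t\ge\tilde e_t^{(i)}b_i\ \ (0\le t\le T-1,\ 1\le i\le n_1),\qquad \sum_{i=1}^{n_1}b_i=p_1 .$$ Then the minimum average radius of an empirical CP-region on $D_{\mathrm{cal},1}$ (as defined in the context) equals $\frac1T\sum_{t=0}^{T-1}r_t^*$. That is, $$\min_{r\in\mathbb{R}^T}\ \frac1T\sum_{t=0}^{T-1}\left(R_r^{[p_1]}+r_t\right)=\frac1T\sum_{t=0}^{T-1}r_t^* .$$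
   Context: Let $d,T,n_1\ge1$. A residual sequence is $\tilde{\mathbf Y}_{0:T-1}=(\tilde Y_0,\dots,\tilde Y_{T-1})$ with each $\tilde Y_t\in\mathbb{R}^d$. For $r=(r_0,\dots,r_{T-1})\in\mathbb{R}^T$ the proposed parameterized score function is $$\mathcal{A}_r(\tilde{\mathbf Y}_{0:T-1})=\max_{0\le t\le T-1}\{\|\tilde Y_t\|-r_t\}.$$ Let $R_r^{[p_1]}$ denote the $p_1$-th smallest value (counted with multiplicity) among the scores $\mathcal{A}_r(\tilde{\mathbf Y}^{(i)}_{0:T-1})$, $i=1,\dots,n_1$. The empirical CP-region on $D_{\mathrm{cal},1}$ with parameters $r$, around a nominal trajectory $(\hat Y_0,\dots,\hat Y_{T-1})$, is the set of all $\mathbf Y\in\mathbb{R}^{d\times T}$ with $\mathcal{A}_r(\mathbf Y-\hat{\mathbf Y}_{0:T-1})\le R_r^{[p_1]}$. It equals the product over $t$ of the norm-balls $\{y\in\mathbb{R}^d:\|y-\hat Y_t\|\le R_r^{[p_1]}+r_t\}$, and its average radius is $\frac1T\sum_{t=0}^{T-1}(R_r^{[p_1]}+r_t)$. *)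

theory Defs
  imports "HOL-Analysis.Analysis"
begin

text \<open>
  Points of \<open>\<real>^d\<close> have type \<open>real ^ 'd\<close>, so that \<open>d = CARD('d) \<ge> 1\<close>. Residual sequences and
  parameter vectors are functions on \<open>nat\<close> of which only the values at \<open>t < T\<close> are used; where
  sets of sequences are compared, the sequences are taken to be extensional on \<open>{..<T}\<close>.
\<close>

definition is_norm :: "('v::real_vector \<Rightarrow> real) \<Rightarrow> bool" where
  "is_norm N \<longleftrightarrow>
     (\<forall>x. N x \<ge> 0) \<and> (\<forall>x. N x = 0 \<longleftrightarrow> x = 0) \<and>
     (\<forall>a x. N (a *\<^sub>R x) = \<bar>a\<bar> * N x) \<and>
     (\<forall>x y. N (x + y) \<le> N x + N y)"

definition is_minimum :: "real set \<Rightarrow> real \<Rightarrow> bool" where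
  "is_minimum S m \<longleftrightarrow> m \<in> S \<and> (\<forall>x\<in>S. m \<le> x)"

definition score ::
  "(real ^ 'd \<Rightarrow> real) \<Rightarrow> nat \<Rightarrow> (nat \<Rightarrow> real) \<Rightarrow> (nat \<Rightarrow> real ^ 'd) \<Rightarrow> real" where
  "score N T r Y = Max ((\<lambda>t. N (Y t) - r t) ` {..<T})"

text \<open>Ranks count from 1, list positions from 0; sorting the list keeps multiplicities.\<close>

definition kth_smallest :: "nat \<Rightarrow> real list \<Rightarrow> real" where
  "kth_smallest k xs = sort xs ! (k - 1)"

text \<open>\<open>D i\<close> for \<open>1 \<le> i \<le> n\<close> is the \<open>i\<close>-th calibration residual sequence.\<close>

definition score_quantile ::
  "(real ^ 'd \<Rightarrow> real) \<Rightarrow> nat \<Rightarrow> nat \<Rightarrow> (nat \<Rightarrow> nat \<Rightarrow> real ^ 'd) \<Rightarrow> nat \<Rightarrow> (nat \<Rightarrow> real) \<Rightarrow> real" where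
  "score_quantile N T n D p r = kth_smallest p (map (\<lambda>i. score N T r (D i)) [1..<Suc n])"

definition cp_region ::
  "(real ^ 'd \<Rightarrow> real) \<Rightarrow> nat \<Rightarrow> nat \<Rightarrow> (nat \<Rightarrow> nat \<Rightarrow> real ^ 'd) \<Rightarrow> nat \<Rightarrow>
   (nat \<Rightarrow> real ^ 'd) \<Rightarrow> (nat \<Rightarrow> real) \<Rightarrow> (nat \<Rightarrow> real ^ 'd) set" where
  "cp_region N T n D p Yhat r =
     {Y \<in> {..<T} \<rightarrow>\<^sub>E UNIV. score N T r (\<lambda>t. Y t - Yhat t) \<le> score_quantile N T n D p r}"

text \<open>
  The average radius as a property of the region itself: the region is a product of norm-balls,
  and \<open>a\<close> is the mean of their radii. The radii are required to be nonnegative because a ball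
  with negative radius is empty and does not determine its radius.
\<close>

definition has_average_radius ::
  "(real ^ 'd \<Rightarrow> real) \<Rightarrow> nat \<Rightarrow> (nat \<Rightarrow> real ^ 'd) set \<Rightarrow> real \<Rightarrow> bool" where
  "has_average_radius N T C a \<longleftrightarrow>
     (\<exists>c \<rho>. (\<forall>t<T. \<rho> t \<ge> 0) \<and>
            C = (\<Pi>\<^sub>E t\<in>{..<T}. {y. N (y - c t) \<le> \<rho> t}) \<and>
            a = (1 / real T) * (\<Sum>t<T. \<rho> t))"

lemma cp_region_eq_PiE:
  assumes "T \<ge> 1"
  shows "cp_region N T n D p Yhat r =
    (\<Pi>\<^sub>E t\<in>{..<T}. {y. N (y - Yhat t) \<le> score_quantile N T n D p r + r t})"
proof -
  have "(score N T r (\<lambda>t. Y t - Yhat t) \<le> q) = (\<forall>t<T. N (Y t - Yhat t) \<le> q + r t)" for Y q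
    unfolding score_def using assms by (subst Max_le_iff) (auto simp: lessThan_empty_iff diff_le_eq)
  then show ?thesis
    by (auto simp: cp_region_def PiE_iff extensional_def)
qed

text \<open>Feasible points \<open>(r, b)\<close> of the mixed-integer program; \<open>e i t\<close> is the norm of the \<open>i\<close>-th residual at time \<open>t\<close>.\<close>

definition milp_feasible ::
  "nat \<Rightarrow> nat \<Rightarrow> (nat \<Rightarrow> nat \<Rightarrow> real) \<Rightarrow> nat \<Rightarrow> (nat \<Rightarrow> real) \<times> (nat \<Rightarrow> real) \<Rightarrow> bool" where
  "milp_feasible T n e p = (\<lambda>(r, b).
     (\<forall>i\<in>{1..n}. b i \<in> {0, 1}) \<and>
     (\<forall>t<T. \<forall>i\<in>{1..n}. r t \<ge> e i t * b i) \<and>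
     (\<Sum>i=1..n. b i) = real p)"

definition milp_optimal ::
  "nat \<Rightarrow> nat \<Rightarrow> (nat \<Rightarrow> nat \<Rightarrow> real) \<Rightarrow> nat \<Rightarrow> (nat \<Rightarrow> real) \<Rightarrow> bool" where
  "milp_optimal T n e p r \<longleftrightarrow>
     (\<exists>b. is_arg_min (\<lambda>(r', b'). \<Sum>t<T. r' t) (milp_feasible T n e p) (r, b))"

end

theory Submission
  imports Defs
begin

text \<open>
  Write \<open>R\<close> for the quantile at parameters \<open>r\<close>. At least \<open>p\<^sub>1\<close> scores are at most \<open>R\<close>; selecting
  exactly \<open>p\<^sub>1\<close> of the corresponding indices as \<open>b\<close> makes the shifted radii \<open>R + r\<^sub>t\<close> feasible for the
  program, so every average radius is at least the optimal value. Conversely, the \<open>p\<^sub>1\<close>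
  sequences selected by an optimal \<open>b\<close> have score at most \<open>0\<close> at \<open>r\<^sup>*\<close>, so the quantile at \<open>r\<^sup>*\<close> is
  at most \<open>0\<close>, and the bound is attained. Finally, balls of a norm on a nonzero space determine
  their radii, so the average radius of a nonempty region is unambiguous.
\<close>

text \<open>In the sorted list the entries at most \<open>q\<close> form an initial segment, so
  position \<open>k - 1\<close> lies in it exactly when its length reaches \<open>k\<close>. This
  turns order statistics into counting.\<close>

lemma kth_smallest_le_iff:
  assumes "1 \<le> k" "k \<le> length xs"
  shows "kth_smallest k xs \<le> q \<longleftrightarrow> k \<le> length (filter (\<lambda>x. x \<le> q) xs)"
proof -
  let ?ys = "sort xs"
  let ?A = "{i. i < length ?ys \<and> ?ys ! i \<le> q}"
  have "length (filter (\<lambda>x. x \<le> q) xs) = length (filter (\<lambda>x. x \<le> q) ?ys)"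
    by (metis filter_sort length_sort)
  then have len: "length (filter (\<lambda>x. x \<le> q) xs) = card ?A"
    by (simp add: length_filter_conv_card)
  have mono: "?ys ! i \<le> ?ys ! j" if "i \<le> j" "j < length xs" for i j
    using that by (simp add: sorted_nth_mono)
  show ?thesis
  proof (cases "?ys ! (k - 1) \<le> q")
    case True
    have "{..<k} \<subseteq> ?A"
    proof
      fix i assume "i \<in> {..<k}"
      then show "i \<in> ?A"
        using order_trans[OF mono[of i "k - 1"] True] assms by simp
    qed
    then have "card {..<k} \<le> card ?A"
      by (intro card_mono) auto
    then show ?thesis
      using True len by (simp add: kth_smallest_def)
  next
    case False
    \<comment> \<open>Position \<open>k - 1\<close> itself is excluded, so fewer than
      \<open>k\<close> positions remain because \<open>k\<close> is at least 1.\<close>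
    have "?A \<subseteq> {..<k - 1}"
    proof
      fix i assume "i \<in> ?A"
      then show "i \<in> {..<k - 1}"
        using mono[of "k - 1" i] False by force
    qed
    then have "card ?A \<le> card {..<k - 1}"
      by (intro card_mono) auto
    then show ?thesis
      using False len assms by (simp add: kth_smallest_def)
  qed
qed

lemma score_quantile_le_iff:
  assumes "1 \<le> p" "p \<le> n"
  shows "score_quantile N T n D p r \<le> q \<longleftrightarrow> p \<le> card {i \<in> {1..n}. score N T r (D i) \<le> q}"
proof -
  \<comment> \<open>The list of indices is distinct, so counting indices instead of values keeps the
    multiplicity of tied scores.\<close>
  have "length (filter (\<lambda>x. x \<le> q) (map (\<lambda>i. score N T r (D i)) [1..<Suc n]))
      = card (set (filter (\<lambda>i. score N T r (D i) \<le> q) [1..<Suc n]))"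
    by (simp add: filter_map comp_def distinct_card del: upt_Suc set_filter)
  also have "\<dots> = card {i \<in> {1..n}. score N T r (D i) \<le> q}"
    by (rule arg_cong[where f = card]) auto
  finally show ?thesis
    using assms by (simp add: score_quantile_def kth_smallest_le_iff del: upt_Suc)
qed

lemma score_le_iff:
  assumes "T \<ge> 1"
  shows "score N T r Y \<le> q \<longleftrightarrow> (\<forall>t<T. N (Y t) \<le> q + r t)"
  unfolding score_def using assms
  by (subst Max_le_iff) (auto simp: lessThan_empty_iff diff_le_eq)

lemma milp_feasible_quantile_shift:
  assumes "is_norm N" "T \<ge> 1" "1 \<le> p" "p \<le> n"
  shows "\<exists>b. milp_feasible T n (\<lambda>i t. N (D i t)) p (\<lambda>t. score_quantile N T n D p r + r t, b)"
proof -
  let ?q = "score_quantile N T n D p r"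
  have "p \<le> card {i \<in> {1..n}. score N T r (D i) \<le> ?q}"
    using score_quantile_le_iff[OF assms(3,4)] by blast
  then obtain B where B: "B \<subseteq> {i \<in> {1..n}. score N T r (D i) \<le> ?q}" "card B = p"
    by (meson obtain_subset_with_card_n)
  have le: "N (D i t) \<le> ?q + r t" if "i \<in> B" "t < T" for i t
    using that B(1) score_le_iff[OF assms(2)] by blast
  \<comment> \<open>An index outside \<open>B\<close> only demands \<open>0 \<le> ?q + r t\<close>.
    Any member of \<open>B\<close> yields this, since a norm is bounded by the same
    quantity.\<close>
  obtain j where "j \<in> B"
    using B(2) assms(3) by fastforce
  then have nonneg: "0 \<le> ?q + r t" if "t < T" for t
    using le[OF _ that] assms(1) unfolding is_norm_def by (meson order_trans)
  have "B \<subseteq> {1..n}"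
    using B(1) by blast
  then have "(\<Sum>i=1..n. indicator B i) = real p"
    using B(2) by (simp add: indicator_def sum.If_cases Int_absorb1)
  then have "milp_feasible T n (\<lambda>i t. N (D i t)) p (\<lambda>t. ?q + r t, indicator B)"
    using le nonneg by (auto simp: milp_feasible_def indicator_def)
  then show ?thesis
    by (rule exI[where x = "indicator B"])
qed

text \<open>For a selected index the constraints say that every norm is at most \<open>r t\<close>,
  which is a score of at most 0; exactly \<open>p\<close> indices are selected.\<close>

lemma score_quantile_nonpos_if_milp_feasible:
  assumes "T \<ge> 1" "1 \<le> p" "p \<le> n"
    and feasible: "milp_feasible T n (\<lambda>i t. N (D i t)) p (r, b)"
  shows "score_quantile N T n D p r \<le> 0"
proof -
  let ?B = "{i \<in> {1..n}. b i = 1}"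
  have b: "b i \<in> {0, 1}" if "i \<in> {1..n}" for i
    using feasible that by (simp add: milp_feasible_def)
  have "real p = (\<Sum>i=1..n. b i)"
    using feasible by (simp add: milp_feasible_def)
  also have "\<dots> = (\<Sum>i=1..n. if b i = 1 then 1 else 0)"
    using b by (intro sum.cong) force+
  also have "\<dots> = real (card ?B)"
    by (simp add: sum.If_cases Int_def)
  finally have "p = card ?B"
    by simp
  moreover have "?B \<subseteq> {i \<in> {1..n}. score N T r (D i) \<le> 0}"
  proof
    fix i assume i: "i \<in> ?B"
    have "N (D i t) * b i \<le> r t" if "t < T" for t
    proof -
      have "\<forall>t<T. \<forall>i\<in>{1..n}. N (D i t) * b i \<le> r t"
        using feasible by (simp add: milp_feasible_def)
      then show ?thesis
        using i that by blast
    qed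
    then show "i \<in> {i \<in> {1..n}. score N T r (D i) \<le> 0}"
      using i by (simp add: score_le_iff[OF assms(1)])
  qed
  then have "card ?B \<le> card {i \<in> {1..n}. score N T r (D i) \<le> 0}"
    by (intro card_mono) auto
  ultimately show ?thesis
    unfolding score_quantile_le_iff[OF assms(2,3)] by linarith
qed

lemma milp_optimal_le_quantile_shift:
  assumes "is_norm N" "T \<ge> 1" "1 \<le> p" "p \<le> n"
    and "milp_optimal T n (\<lambda>i t. N (D i t)) p rstar"
  shows "(\<Sum>t<T. rstar t) \<le> (\<Sum>t<T. score_quantile N T n D p r + r t)"
proof -
  obtain b where "milp_feasible T n (\<lambda>i t. N (D i t)) p (\<lambda>t. score_quantile N T n D p r + r t, b)"
    using milp_feasible_quantile_shift[OF assms(1-4)] by blast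
  then show ?thesis
    using assms(5) by (fastforce simp: milp_optimal_def is_arg_min_linorder)
qed

lemma milp_optimal_eq_quantile_shift:
  assumes "is_norm N" "T \<ge> 1" "1 \<le> p" "p \<le> n"
    and opt: "milp_optimal T n (\<lambda>i t. N (D i t)) p rstar"
  shows "(\<Sum>t<T. score_quantile N T n D p rstar + rstar t) = (\<Sum>t<T. rstar t)"
proof (rule antisym)
  obtain b where "milp_feasible T n (\<lambda>i t. N (D i t)) p (rstar, b)"
    using opt by (auto simp: milp_optimal_def is_arg_min_def)
  then have "score_quantile N T n D p rstar \<le> 0"
    by (rule score_quantile_nonpos_if_milp_feasible[OF assms(2-4)])
  then show "(\<Sum>t<T. score_quantile N T n D p rstar + rstar t) \<le> (\<Sum>t<T. rstar t)"
    by (intro sum_mono) simp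
qed (rule milp_optimal_le_quantile_shift[OF assms])

text \<open>The first ball contains two antipodal points \<open>c + v\<close> and
  \<open>c - v\<close> at distance \<open>2 * s\<close>, while two points of the second ball are at
  distance at most \<open>2 * s'\<close>. The centers need not agree.\<close>

lemma norm_ball_subset_radius_le:
  fixes N :: "'v::real_vector \<Rightarrow> real"
  assumes N: "is_norm N" and "(u::'v) \<noteq> 0" and "0 \<le> s"
    and sub: "{y. N (y - c) \<le> s} \<subseteq> {y. N (y - c') \<le> s'}"
  shows "s \<le> s'"
proof -
  have scale: "N (a *\<^sub>R x) = \<bar>a\<bar> * N x" for a x
    using N by (simp add: is_norm_def)
  have triangle: "N (x + y) \<le> N x + N y" for x y
    using N by (simp add: is_norm_def)
  have "N u > 0"
    using N \<open>u \<noteq> 0\<close> by (metis is_norm_def less_eq_real_def)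
  \<comment> \<open>The nonzero vector \<open>u\<close> only supplies a direction; it is rescaled to
    norm \<open>s\<close>.\<close>
  define v where "v = (s / N u) *\<^sub>R u"
  have v: "N v = s"
    using \<open>N u > 0\<close> \<open>0 \<le> s\<close> by (simp add: v_def scale)
  have neg: "N (- x) = N x" for x
    using scale[of "-1" x] by simp
  have "c + v \<in> {y. N (y - c) \<le> s}"
    using v by simp
  then have plus: "N (c + v - c') \<le> s'"
    using sub by blast
  have "c - v \<in> {y. N (y - c) \<le> s}"
    using v neg by simp
  then have minus: "N (c - v - c') \<le> s'"
    using sub by blast
  have "2 * s = N ((2::real) *\<^sub>R v)"
    by (simp add: scale v)
  also have "(2::real) *\<^sub>R v = (c + v - c') + - (c - v - c')"
    by (simp add: scaleR_2)
  also have "N \<dots> \<le> N (c + v - c') + N (c - v - c')"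
    using triangle neg by metis
  finally show ?thesis
    using plus minus by simp
qed

lemma norm_ball_radius_unique:
  fixes N :: "'v::real_vector \<Rightarrow> real"
  assumes "is_norm N" "(u::'v) \<noteq> 0" "0 \<le> s" "0 \<le> s'"
    and "{y. N (y - c) \<le> s} = {y. N (y - c') \<le> s'}"
  shows "s = s'"
  using assms by (intro antisym) (auto intro: norm_ball_subset_radius_le)

text \<open>All radii of the region are nonnegative, so its factors are nonempty and can be
  recovered from the product; each factor then determines its radius, whatever center is used to
  describe it.\<close>

lemma has_average_radius_cp_region_iff:
  fixes N :: "real ^ 'd \<Rightarrow> real"
  assumes N: "is_norm N" and "T \<ge> 1" "1 \<le> p" "p \<le> n"
  shows "has_average_radius N T (cp_region N T n D p Yhat r) a \<longleftrightarrow>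
         a = (1 / real T) * (\<Sum>t<T. score_quantile N T n D p r + r t)"
proof -
  let ?R = "\<lambda>t. score_quantile N T n D p r + r t"
  have R_nonneg: "0 \<le> ?R t" if "t < T" for t
  proof -
    obtain b where b: "milp_feasible T n (\<lambda>i t. N (D i t)) p (?R, b)"
      using milp_feasible_quantile_shift[OF assms] by blast
    \<comment> \<open>Index 1 exists because \<open>1 \<le> p \<le> n\<close>, and its lower bound
      on the radius is nonnegative for either value of \<open>b 1\<close>.\<close>
    then have "b 1 \<in> {0, 1}" "N (D 1 t) * b 1 \<le> ?R t"
      using that \<open>1 \<le> p\<close> \<open>p \<le> n\<close> by (auto simp: milp_feasible_def)
    moreover have "0 \<le> N (D 1 t)"
      using N by (simp add: is_norm_def)
    ultimately show ?thesis
      by auto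
  qed
  have "N 0 = 0"
    using N by (metis is_norm_def)
  then have center: "x \<in> {y. N (y - x) \<le> \<rho>}" if "0 \<le> \<rho>" for x \<rho>
    using that by simp
  have region: "cp_region N T n D p Yhat r = (\<Pi>\<^sub>E t\<in>{..<T}. {y. N (y - Yhat t) \<le> ?R t})"
    by (rule cp_region_eq_PiE[OF assms(2)])
  show ?thesis
  proof
    assume "has_average_radius N T (cp_region N T n D p Yhat r) a"
    then obtain c \<rho> where \<rho>: "\<forall>t<T. 0 \<le> \<rho> t"
      and eq: "(\<Pi>\<^sub>E t\<in>{..<T}. {y. N (y - Yhat t) \<le> ?R t}) = (\<Pi>\<^sub>E t\<in>{..<T}. {y. N (y - c t) \<le> \<rho> t})"
      and a: "a = (1 / real T) * (\<Sum>t<T. \<rho> t)"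
      unfolding has_average_radius_def region by (elim exE conjE)
    have "\<rho> t = ?R t" if "t < T" for t
    proof -
      have "{y. N (y - Yhat t) \<le> ?R t} \<noteq> {}" if "t \<in> {..<T}" for t
        using center[OF R_nonneg[OF that[unfolded lessThan_iff]], of "Yhat t"] by blast
      moreover have "{y. N (y - c t) \<le> \<rho> t} \<noteq> {}" if "t \<in> {..<T}" for t
        using center[of "\<rho> t" "c t"] \<rho> that by blast
      ultimately have "\<forall>t\<in>{..<T}. {y. N (y - Yhat t) \<le> ?R t} = {y. N (y - c t) \<le> \<rho> t}"
        using eq by (subst (asm) PiE_eq_iff_not_empty)
      then have "{y. N (y - Yhat t) \<le> ?R t} = {y. N (y - c t) \<le> \<rho> t}"
        using that by simp
      then have "?R t = \<rho> t"
        \<comment> \<open>The all-ones vector is the nonzero direction.\<close>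
        using R_nonneg[OF that] \<rho> that by (intro norm_ball_radius_unique[OF N one_neq_zero]) auto
      then show ?thesis ..
    qed
    then show "a = (1 / real T) * (\<Sum>t<T. ?R t)"
      using a by simp
  next
    assume "a = (1 / real T) * (\<Sum>t<T. ?R t)"
    then show "has_average_radius N T (cp_region N T n D p Yhat r) a"
      unfolding has_average_radius_def region using R_nonneg
      by (intro exI[of _ Yhat] exI[of _ ?R] conjI) simp_all
  qed
qed

text \<open>The lower bound on \<open>\<epsilon>\<close> removes at least 1 from
  \<open>real n + 1\<close>, and taking the ceiling cannot exceed the integer
  \<open>n\<close>.\<close>

lemma quantile_rank_bounds:
  fixes \<epsilon> :: real
  assumes "\<epsilon> < 1" "\<epsilon> \<ge> 1 / (real n + 1)"
  shows "1 \<le> nat \<lceil>(1 - \<epsilon>) * (real n + 1)\<rceil>" "nat \<lceil>(1 - \<epsilon>) * (real n + 1)\<rceil> \<le> n"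
proof -
  have "0 < (1 - \<epsilon>) * (real n + 1)"
    using assms(1) by simp
  then show "1 \<le> nat \<lceil>(1 - \<epsilon>) * (real n + 1)\<rceil>"
    by linarith
  have "1 \<le> \<epsilon> * (real n + 1)"
    using assms(2) by (simp add: divide_le_eq)
  then have "(1 - \<epsilon>) * (real n + 1) \<le> real n"
    by (simp add: algebra_simps)
  then show "nat \<lceil>(1 - \<epsilon>) * (real n + 1)\<rceil> \<le> n"
    by linarith
qed

theorem theorem2:
  fixes N :: "real ^ 'd \<Rightarrow> real"
    and T n1 p1 :: nat
    and \<epsilon> :: real
    and D :: "nat \<Rightarrow> nat \<Rightarrow> real ^ 'd"
    and rstar :: "nat \<Rightarrow> real"
    and Yhat :: "nat \<Rightarrow> real ^ 'd"
  assumes "is_norm N"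
    and "T \<ge> 1" and "n1 \<ge> 1"
    and "0 < \<epsilon>" and "\<epsilon> < 1"
    and "\<epsilon> \<ge> 1 / (real n1 + 1)"
    and "p1 = nat \<lceil>(1 - \<epsilon>) * (real n1 + 1)\<rceil>"
    and "milp_optimal T n1 (\<lambda>i t. N (D i t)) p1 rstar"
  shows "is_minimum {a. \<exists>r. has_average_radius N T (cp_region N T n1 D p1 Yhat r) a}
           ((1 / real T) * (\<Sum>t<T. rstar t))
       \<and> is_minimum (range (\<lambda>r. (1 / real T) * (\<Sum>t<T. (score_quantile N T n1 D p1 r + r t))))
           ((1 / real T) * (\<Sum>t<T. rstar t))"
proof -
  have p: "1 \<le> p1" "p1 \<le> n1"
    using quantile_rank_bounds[OF assms(5,6)] assms(7) by simp_all
  let ?avg = "\<lambda>r. (1 / real T) * (\<Sum>t<T. (score_quantile N T n1 D p1 r + r t))"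
  let ?m = "(1 / real T) * (\<Sum>t<T. rstar t)"
  have "?m = ?avg rstar"
    using milp_optimal_eq_quantile_shift[OF assms(1,2) p assms(8)] by simp
  moreover have "?m \<le> ?avg r" for r
    using milp_optimal_le_quantile_shift[OF assms(1,2) p assms(8)] by (intro mult_left_mono) auto
  ultimately have "is_minimum (range ?avg) ?m"
    unfolding is_minimum_def by blast
  \<comment> \<open>Each \<open>r\<close> gives exactly one average radius, so minimizing over
    regions and minimizing the formula are the same problem.\<close>
  moreover have "{a. \<exists>r. has_average_radius N T (cp_region N T n1 D p1 Yhat r) a} = range ?avg"
    by (auto simp: has_average_radius_cp_region_iff[OF assms(1,2) p])
  ultimately show ?thesis
    by simp
qed

end
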